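(* Let $n\in\mathbb{N}$, and let $S_m$ ($m\in\mathbb{N}$) and $S_*$ be interval translation maps of $n$ intervals, where $S_m$ has parameters $t_0^m,\dots,t_n^m$, $c_1^m,\dots,c_n^m$ and $S_*$ has parameters $t_0^*,\dots,t_n^*$, $c_1^*,\dots,c_n^*$. Suppose that the parameters of $S_m$ converge to those of $S_*$, i.e. $t_k^m\to t_k^*$ for $k=0,\dots,n$ and $c_k^m\to c_k^*$ for $k=1,\dots,n$ as $m\to\infty$. For each $m$ let $\mu_m$ be an invariant Borel probability measure for $S_m$, and suppose that the measures $\mu_m$ converge $*$-weakly to a Borel probability measure $\mu_*$. If $\mu_*(\{t_k^*\})=0$ for every $k\in\{0,\dots,n\}$, then $\mu_*$ is an invariant measure for $S_*$.
   Context: An interval translation map (ITM) of $n$ intervals is a map $S:[0,1)\to[0,1)$ determined by parameters $0=t_0<t_1<\dots<t_n=1$ and real numbers $c_1,\dots,c_n$ with $0\le t_{k-1}+c_k<t_k+c_k\le 1$ for all $k=1,\dots,n$, via $S(t)=t+c_k$ for $t\in I_k:=[t_{k-1},t_k)$. A Borel probability measure $\mu$ on $[0,1)$ is invariant for $S$ if $\mu(S^{-1}(B))=\mu(B)$ for every Borel set $B\subset[0,1)$. Measures on $[0,1)$ are regarded also as measures on $[0,1]$ giving zero mass to $\{1\}$; $\mu_m\to\mu_*$ $*$-weakly means $\int_{[0,1]}\varphi\,d\mu_m\to\int_{[0,1]}\varphi\,d\mu_*$ for every continuous $\varphi:[0,1]\to\mathbb{R}$. *)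

theory Defs
  imports "HOL-Probability.Probability"
begin

text \<open>
  An interval translation map of \<open>n\<close> intervals with parameters \<open>t 0, \<dots>, t n\<close> and
  \<open>c 1, \<dots>, c n\<close>; entries of \<open>t\<close> and \<open>c\<close> with other indices are irrelevant. A map
  on \<open>[0,1)\<close> is represented by a function on the reals whose values outside \<open>[0,1)\<close> are
  unconstrained. The conditions at \<open>0\<close> and \<open>n\<close> force \<open>n \<ge> 1\<close>.
\<close>

definition itm :: "nat \<Rightarrow> (nat \<Rightarrow> real) \<Rightarrow> (nat \<Rightarrow> real) \<Rightarrow> (real \<Rightarrow> real) \<Rightarrow> bool" where
  "itm n t c S \<longleftrightarrow>
     t 0 = 0 \<and> t n = 1 \<and>
     (\<forall>k\<in>{1..n}. t (k - 1) < t k) \<and>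
     (\<forall>k\<in>{1..n}. 0 \<le> t (k - 1) + c k \<and> t (k - 1) + c k < t k + c k \<and> t k + c k \<le> 1) \<and>
     (\<forall>k\<in>{1..n}. \<forall>x\<in>{t (k - 1)..<t k}. S x = x + c k)"

definition borel_prob_on :: "real set \<Rightarrow> real measure \<Rightarrow> bool" where
  "borel_prob_on X M \<longleftrightarrow> prob_space M \<and> sets M = sets (restrict_space borel X)"

definition itm_invariant :: "(real \<Rightarrow> real) \<Rightarrow> real measure \<Rightarrow> bool" where
  "itm_invariant S M \<longleftrightarrow>
     borel_prob_on {0..<1} M \<and>
     (\<forall>B. B \<in> sets borel \<and> B \<subseteq> {0..<1} \<longrightarrow> emeasure M (S -` B \<inter> {0..<1}) = emeasure M B)"

text \<open>A measure on \<open>[0,1)\<close> regarded as a measure on \<open>[0,1]\<close> (push-forward under inclusion).\<close>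

definition to_closed :: "real measure \<Rightarrow> real measure" where
  "to_closed M = distr M (restrict_space borel {0..1}) (\<lambda>x. x)"

definition weak_star_conv :: "(nat \<Rightarrow> real measure) \<Rightarrow> real measure \<Rightarrow> bool" where
  "weak_star_conv M N \<longleftrightarrow>
     (\<forall>\<phi> :: real \<Rightarrow> real. continuous_on {0..1} \<phi> \<longrightarrow>
        (\<lambda>m. \<integral>x. \<phi> x \<partial>(M m)) \<longlonglongrightarrow> (\<integral>x. \<phi> x \<partial>N))"

lemma itm_cover:
  assumes "itm n t c S" and "x \<in> {0..<1}"
  obtains k where "k \<in> {1..n}" and "x \<in> {t (k - 1)..<t k}"
proof -
  have t: "t 0 = 0" "t n = 1" using assms(1) by (auto simp: itm_def)
  define k where "k = (LEAST k. x < t k)"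
  have ex: "x < t n" using t assms(2) by simp
  have k: "x < t k" unfolding k_def using ex by (rule LeastI)
  have "k \<le> n" unfolding k_def using ex by (rule Least_le)
  have "k \<noteq> 0" using k t assms(2) by (cases k) auto
  moreover have "\<not> x < t (k - 1)"
    unfolding k_def by (rule not_less_Least) (use \<open>k \<noteq> 0\<close> k_def in simp)
  ultimately show ?thesis using that[of k] k \<open>k \<le> n\<close> by auto
qed

text \<open>
  Hence the preimages in \<open>itm_invariant\<close> are measurable, and \<open>emeasure\<close> does not take its
  default value \<open>0\<close> on them.
\<close>

lemma itm_vimage_borel:
  assumes "itm n t c S" and "B \<in> sets borel"
  shows "S -` B \<inter> {0..<1} \<in> sets borel"
proof -
  have S: "S x = x + c k" if "k \<in> {1..n}" "x \<in> {t (k - 1)..<t k}" for k x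
    using assms(1) that unfolding itm_def by blast
  have eq: "S -` B \<inter> {0..<1} =
      (\<Union>k\<in>{1..n}. (\<lambda>x. x + c k) -` B \<inter> {t (k - 1)..<t k} \<inter> {0..<1})"
    (is "?L = ?R")
  proof (intro equalityI subsetI)
    fix x assume x: "x \<in> ?L"
    then obtain k where "k \<in> {1..n}" "x \<in> {t (k - 1)..<t k}"
      using itm_cover[OF assms(1), of x] by blast
    then show "x \<in> ?R" using x S by auto
  next
    fix x assume "x \<in> ?R" then show "x \<in> ?L" using S by auto
  qed
  have "(\<lambda>x. x + c k) -` B \<in> sets borel" for k
    using measurable_sets[of "\<lambda>x. x + c k" borel borel B] assms(2) by simp
  then show ?thesis unfolding eq by (intro sets.finite_UN sets.Int) auto
qed

lemma
  assumes "borel_prob_on {0..<1} M"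
  shows borel_prob_on_to_closed: "borel_prob_on {0..1} (to_closed M)"
    and emeasure_to_closed: "B \<in> sets borel \<Longrightarrow> B \<subseteq> {0..1} \<Longrightarrow>
           emeasure (to_closed M) B = emeasure M (B \<inter> {0..<1})"
    and emeasure_to_closed_1: "emeasure (to_closed M) {1} = 0"
proof -
  interpret prob_space M using assms by (simp add: borel_prob_on_def)
  have sp: "space M = {0..<1}" and se: "sets M = sets (restrict_space borel {0..<1})"
    using assms sets_eq_imp_space_eq[of M "restrict_space borel {0..<1}"]
    by (auto simp: borel_prob_on_def space_restrict_space)
  have "(\<lambda>x. x) \<in> restrict_space borel {0..<1} \<rightarrow>\<^sub>M restrict_space borel {0..1::real}"
    by (rule measurable_restrict_space2)
      (auto simp: space_restrict_space intro: measurable_restrict_space1)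
  then have m: "(\<lambda>x. x) \<in> M \<rightarrow>\<^sub>M restrict_space borel {0..1::real}"
    by (simp only: measurable_cong_sets[OF se refl])
  show "borel_prob_on {0..1} (to_closed M)"
    unfolding borel_prob_on_def to_closed_def using prob_space_distr[OF m] by simp
  show *: "emeasure (to_closed M) B = emeasure M (B \<inter> {0..<1})"
    if "B \<in> sets borel" "B \<subseteq> {0..1}" for B
    unfolding to_closed_def
    by (subst emeasure_distr[OF m]) (use that sp in \<open>auto simp: sets_restrict_space_iff\<close>)
  show "emeasure (to_closed M) {1} = 0" by (subst *) auto
qed

lemma restrict_space_to_closed:
  assumes "borel_prob_on {0..<1} M"
  shows "restrict_space (to_closed M) {0..<1} = M"
proof (rule measure_eqI)
  have X: "sets (to_closed M) = sets (restrict_space borel {0..1})"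
    by (simp add: to_closed_def)
  have se: "sets M = sets (restrict_space borel {0..<1})"
    using assms by (simp add: borel_prob_on_def)
  have i: "{0..1} \<inter> {0..<1} = {0..<1::real}" by auto
  have "sets (restrict_space (to_closed M) {0..<1}) =
      sets (restrict_space (restrict_space borel {0..1}) {0..<1::real})"
    by (rule sets_restrict_space_cong[OF X])
  also have "\<dots> = sets M"
    unfolding se by (subst sets_restrict_restrict_space) (simp only: i)
  finally show sets: "sets (restrict_space (to_closed M) {0..<1}) = sets M" .
  fix A assume "A \<in> sets (restrict_space (to_closed M) {0..<1})"
  then have A: "A \<in> sets borel" "A \<subseteq> {0..<1}"
    unfolding sets se by (auto simp: sets_restrict_space_iff)
  have sp: "space (to_closed M) = {0..1}"
    by (simp add: to_closed_def space_restrict_space)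
  have "{0..<1} \<in> sets (to_closed M)"
    unfolding X by (auto simp: sets_restrict_space_iff)
  then have "emeasure (restrict_space (to_closed M) {0..<1}) A = emeasure (to_closed M) A"
    using A(2) by (intro emeasure_restrict_space) (simp_all only: sp Int_commute[of _ "{0..1}"] i)
  also have "\<dots> = emeasure M (A \<inter> {0..<1})"
    using A by (intro emeasure_to_closed[OF assms]) auto
  finally show "emeasure (restrict_space (to_closed M) {0..<1}) A = emeasure M A"
    using A(2) by (simp add: Int_absorb2)
qed

end

theory Submission imports Defs begin

text \<open>
  Extended by zero outside \<open>[0,1)\<close>, the maps \<open>S m\<close> converge continuously to \<open>S'\<close> at every point of
  \<open>[0,1)\<close> that is not an endpoint \<open>t' k\<close>, that is, at \<open>\<mu>'\<close>-almost every point. By Skorohod's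
  representation theorem, the push-forwards of \<open>\<mu> m\<close> under \<open>S m\<close> then converge weakly to the
  push-forward of \<open>\<mu>'\<close> under \<open>S'\<close>. These push-forwards are the \<open>\<mu> m\<close> themselves, so uniqueness of
  weak limits shows that \<open>\<mu>'\<close> is its own push-forward.
\<close>

text \<open>This is the extended continuous mapping theorem, with maps that vary with
  \<open>m\<close>. Skorohod's theorem replaces the laws by variables \<open>Y m\<close> converging
  pointwise to \<open>Y'\<close> on one space, where the convergence of
  \<open>g m (Y m \<omega>)\<close> can be tested point by point. The hypothesis ranges over all
  sequences \<open>X\<close> because the values \<open>Y m \<omega>\<close> are not known in
  advance.\<close>

theorem weak_conv_m_distr_extended:
  fixes M :: "nat \<Rightarrow> real measure" and M' :: "real measure"
    and g :: "nat \<Rightarrow> real \<Rightarrow> real" and g' :: "real \<Rightarrow> real"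
  assumes M: "\<And>m. real_distribution (M m)" "real_distribution M'"
    and conv: "weak_conv_m M M'"
    and g: "\<And>m. g m \<in> borel_measurable borel" "g' \<in> borel_measurable borel"
    and cont: "AE x in M'. \<forall>X. X \<longlonglongrightarrow> x \<longrightarrow> (\<lambda>m. g m (X m)) \<longlonglongrightarrow> g' x"
  shows "weak_conv_m (\<lambda>m. distr (M m) borel (g m)) (distr M' borel g')"
proof -
  note [measurable] = g
  obtain \<Omega> :: "real measure" and Y Y' where \<Omega>: "prob_space \<Omega>"
    and Y[measurable]: "\<And>m. Y m \<in> borel_measurable \<Omega>"
    and dY: "\<And>m. distr \<Omega> borel (Y m) = M m"
    and "Y' \<in> \<Omega> \<rightarrow>\<^sub>M lborel" and dY': "distr \<Omega> borel Y' = M'"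
    and lim: "\<And>\<omega>. \<omega> \<in> space \<Omega> \<Longrightarrow> (\<lambda>m. Y m \<omega>) \<longlonglongrightarrow> Y' \<omega>"
    using Skorohod[OF M conv] by blast
  then have [measurable]: "Y' \<in> borel_measurable \<Omega>" by simp
  interpret \<Omega>: prob_space \<Omega> by fact
  have d: "distr (M m) borel (g m) = distr \<Omega> borel (\<lambda>\<omega>. g m (Y m \<omega>))" for m
    unfolding dY[symmetric] by (subst distr_distr) (auto simp: comp_def)
  have d': "distr M' borel g' = distr \<Omega> borel (\<lambda>\<omega>. g' (Y' \<omega>))"
    unfolding dY'[symmetric] by (subst distr_distr) (auto simp: comp_def)
  \<comment> \<open>Since \<open>M'\<close> is the law of \<open>Y'\<close>, the exceptional set
    pulls back to a null set of \<open>\<Omega>\<close>; then \<open>X\<close> is taken to be the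
    sequence \<open>Y m \<omega>\<close>.\<close>
  have "AE \<omega> in \<Omega>. \<forall>X. X \<longlonglongrightarrow> Y' \<omega> \<longrightarrow> (\<lambda>m. g m (X m)) \<longlonglongrightarrow> g' (Y' \<omega>)"
    using cont unfolding dY'[symmetric] by (rule AE_distrD[rotated]) simp
  then have ae: "AE \<omega> in \<Omega>. (\<lambda>m. g m (Y m \<omega>)) \<longlonglongrightarrow> g' (Y' \<omega>)"
    using lim AE_space by (auto elim!: AE_mp)
  show ?thesis
    unfolding d d'
  proof (rule integral_bdd_continuous_conv_imp_weak_conv)
    fix f :: "real \<Rightarrow> real" assume f: "\<And>x. isCont f x" "\<And>x. \<bar>f x\<bar> \<le> 1"
    then have [measurable]: "f \<in> borel_measurable borel"
      by (intro borel_measurable_continuous_onI continuous_at_imp_continuous_on) auto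
    have "(\<lambda>m. \<integral>\<omega>. f (g m (Y m \<omega>)) \<partial>\<Omega>) \<longlonglongrightarrow> (\<integral>\<omega>. f (g' (Y' \<omega>)) \<partial>\<Omega>)"
    proof (rule integral_dominated_convergence[where w="\<lambda>_. 1"])
      show "AE \<omega> in \<Omega>. (\<lambda>m. f (g m (Y m \<omega>))) \<longlonglongrightarrow> f (g' (Y' \<omega>))"
        using ae by eventually_elim (rule isCont_tendsto_compose[OF f(1)])
    qed (use f(2) in auto)
    then show "(\<lambda>m. integral\<^sup>L (distr \<Omega> borel (\<lambda>\<omega>. g m (Y m \<omega>))) f) \<longlonglongrightarrow>
        integral\<^sup>L (distr \<Omega> borel (\<lambda>\<omega>. g' (Y' \<omega>))) f"
      by (simp add: integral_distr)
  qed (auto intro!: \<Omega>.real_distribution_distr)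
qed

text \<open>Weak convergence gives pointwise convergence of characteristic functions, whose limits
  are unique and determine the distribution.\<close>

lemma weak_conv_m_unique:
  assumes "\<And>m. real_distribution (M m)" "real_distribution N" "real_distribution N'"
    and "weak_conv_m M N" "weak_conv_m M N'"
  shows "N = N'"
proof (rule Levy_uniqueness)
  show "char N = char N'"
    using levy_continuity1[of M N] levy_continuity1[of M N'] assms by (blast intro: LIMSEQ_unique)
qed fact+

text \<open>Pushing \<open>M\<close> forward to the whole line makes it a
  \<open>real_distribution\<close>, the setting of Skorohod's and Levy's theorems.\<close>

lemma borel_prob_onD:
  assumes "borel_prob_on X M"
  shows space_borel_prob_on: "space M = X"
    and measurable_id_borel_prob_on: "(\<lambda>x. x) \<in> borel_measurable M"
    and real_distribution_borel_prob_on: "real_distribution (distr M borel (\<lambda>x. x))"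
    and emeasure_distr_id_borel_prob_on: "B \<in> sets borel \<Longrightarrow>
      emeasure (distr M borel (\<lambda>x. x)) B = emeasure M (B \<inter> X)"
proof -
  have M: "prob_space M" "sets M = sets (restrict_space borel X)"
    using assms by (auto simp: borel_prob_on_def)
  show sp: "space M = X"
    using sets_eq_imp_space_eq[OF M(2)] by (simp add: space_restrict_space)
  show m: "(\<lambda>x. x) \<in> borel_measurable M"
    by (simp only: measurable_cong_sets[OF M(2) refl]) (auto intro: measurable_restrict_space1)
  show "real_distribution (distr M borel (\<lambda>x. x))"
    using prob_space.real_distribution_distr[OF M(1) m] .
  show "emeasure (distr M borel (\<lambda>x. x)) B = emeasure M (B \<inter> X)" if "B \<in> sets borel"
    using that by (subst emeasure_distr[OF m]) (auto simp: sp)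
qed

lemma itm_range:
  assumes "itm n t c S" and "x \<in> {0..<1}"
  shows "S x \<in> {0..<1}"
proof -
  obtain k where k: "k \<in> {1..n}" "x \<in> {t (k - 1)..<t k}"
    using itm_cover[OF assms] .
  then have "S x = x + c k" "0 \<le> t (k - 1) + c k" "t k + c k \<le> 1"
    using assms(1) unfolding itm_def by blast+
  then show ?thesis using k(2) by auto
qed

text \<open>The values of \<open>S\<close> outside \<open>[0,1)\<close> are unconstrained, so
  \<open>S\<close> may fail to be Borel on the line. A constant value there restores measurability,
  and measures concentrated on \<open>[0,1)\<close> do not see it.\<close>

definition zero_ext :: "(real \<Rightarrow> real) \<Rightarrow> real \<Rightarrow> real" where
  "zero_ext S x = (if x \<in> {0..<1} then S x else 0)"

lemma zero_ext_measurable: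
  assumes "itm n t c S"
  shows "zero_ext S \<in> borel_measurable borel"
proof (rule measurableI)
  fix B :: "real set" assume B: "B \<in> sets borel"
  have "zero_ext S -` B = (S -` B \<inter> {0..<1}) \<union> (if 0 \<in> B then - {0..<1} else {})"
    by (auto simp: zero_ext_def split: if_splits)
  then show "zero_ext S -` B \<inter> space borel \<in> sets borel"
    using itm_vimage_borel[OF assms B] by auto
qed simp

text \<open>Both sides of the invariance equation depend on \<open>B\<close> only through its trace
  on \<open>[0,1)\<close>: \<open>N\<close> is concentrated there, and \<open>S\<close> maps
  \<open>[0,1)\<close> into itself. Hence testing Borel subsets of \<open>[0,1)\<close> amounts to
  testing all Borel sets of the line.\<close>

lemma itm_invariant_iff_distr:
  assumes S: "itm n t c S" and M: "borel_prob_on {0..<1} M"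
  defines "N \<equiv> distr M borel (\<lambda>x. x)"
  shows "itm_invariant S M \<longleftrightarrow> distr N borel (zero_ext S) = N"
proof -
  have em: "emeasure N B = emeasure M (B \<inter> {0..<1})" if "B \<in> sets borel" for B
    unfolding N_def using emeasure_distr_id_borel_prob_on[OF M that] .
  have z: "zero_ext S \<in> N \<rightarrow>\<^sub>M borel"
    unfolding N_def using zero_ext_measurable[OF S] by simp
  have emd: "emeasure (distr N borel (zero_ext S)) B
      = emeasure M (S -` (B \<inter> {0..<1}) \<inter> {0..<1})" if B: "B \<in> sets borel" for B
  proof -
    have v: "zero_ext S -` B \<in> sets borel"
      using measurable_sets[OF zero_ext_measurable[OF S] B] by simp
    have "zero_ext S -` B \<inter> {0..<1} = S -` (B \<inter> {0..<1}) \<inter> {0..<1}"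
      using itm_range[OF S] by (auto simp: zero_ext_def)
    then show ?thesis
      using em[OF v] by (subst emeasure_distr[OF z B]) (simp add: N_def)
  qed
  show ?thesis
  proof
    assume inv: "itm_invariant S M"
    show "distr N borel (zero_ext S) = N"
    proof (rule measure_eqI)
      fix B assume "B \<in> sets (distr N borel (zero_ext S))"
      then have B: "B \<in> sets borel" by simp
      show "emeasure (distr N borel (zero_ext S)) B = emeasure N B"
        unfolding emd[OF B] em[OF B]
        using inv sets.Int[OF B, of "{0..<1}"] unfolding itm_invariant_def by auto
    qed (simp add: N_def)
  next
    assume eq: "distr N borel (zero_ext S) = N"
    have "emeasure M (S -` B \<inter> {0..<1}) = emeasure M B"
      if B: "B \<in> sets borel" "B \<subseteq> {0..<1}" for B
      using emd[OF B(1)] em[OF B(1)] B(2) unfolding eq by (simp add: Int_absorb2)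
    then show "itm_invariant S M" using M by (auto simp: itm_invariant_def)
  qed
qed

text \<open>A point that is no endpoint is interior to some branch interval of \<open>S'\<close>.
  The strict inequalities persist in the limit, so \<open>X m\<close> eventually lies in the
  interval of \<open>S m\<close> with the same index \<open>k\<close>, where the map is translation
  by \<open>c m k\<close>.\<close>

lemma itm_continuous_convergence:
  assumes S: "\<And>m. itm n (t m) (c m) (S m)" and S': "itm n t' c' S'"
    and t: "\<And>k. k \<in> {0..n} \<Longrightarrow> (\<lambda>m. t m k) \<longlonglongrightarrow> t' k"
    and c: "\<And>k. k \<in> {1..n} \<Longrightarrow> (\<lambda>m. c m k) \<longlonglongrightarrow> c' k"
    and x: "x \<in> {0..<1}" "x \<notin> t' ` {0..n}" and X: "X \<longlonglongrightarrow> x"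
  shows "(\<lambda>m. zero_ext (S m) (X m)) \<longlonglongrightarrow> zero_ext S' x"
proof -
  obtain k where k: "k \<in> {1..n}" "x \<in> {t' (k - 1)..<t' k}"
    using itm_cover[OF S' x(1)] .
  \<comment> \<open>Branch intervals contain their left endpoint, at which \<open>S'\<close> may
    jump; avoiding it makes both inequalities strict.\<close>
  have "x \<noteq> t' (k - 1)" using x(2) k(1) by auto
  then have k': "t' (k - 1) < x" "x < t' k" using k(2) by auto
  have "\<forall>\<^sub>F m in sequentially. 0 < X m" "\<forall>\<^sub>F m in sequentially. X m < 1"
  proof -
    have "x \<noteq> t' 0" using x(2) by auto
    then have "0 < x" "x < 1" using x(1) S' by (auto simp: itm_def)
    then show "\<forall>\<^sub>F m in sequentially. 0 < X m" "\<forall>\<^sub>F m in sequentially. X m < 1"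
      using order_tendstoD[OF X] by auto
  qed
  moreover have "\<forall>\<^sub>F m in sequentially. 0 < X m - t m (k - 1)"
    using k k' by (intro order_tendstoD(1)[OF tendsto_diff[OF X t]]) auto
  moreover have "\<forall>\<^sub>F m in sequentially. 0 < t m k - X m"
    using k k' by (intro order_tendstoD(1)[OF tendsto_diff[OF t X]]) auto
  ultimately have "\<forall>\<^sub>F m in sequentially. X m + c m k = zero_ext (S m) (X m)"
  proof eventually_elim
    case (elim m)
    then have "X m \<in> {t m (k - 1)..<t m k}" by auto
    then have "S m (X m) = X m + c m k" using S[of m] k(1) unfolding itm_def by blast
    then show ?case using elim by (simp add: zero_ext_def)
  qed
  moreover have "(\<lambda>m. X m + c m k) \<longlonglongrightarrow> x + c' k"
    by (intro tendsto_add X c k)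
  moreover have "S' x = x + c' k" using S' k unfolding itm_def by blast
  ultimately show ?thesis
    using x(1) by (auto simp: zero_ext_def intro: Lim_transform_eventually)
qed

text \<open>A bounded continuous test function on the line restricts to a continuous one on
  \<open>[0,1]\<close>, and all the push-forwards involved are along inclusions, so the integrals do
  not change.\<close>

lemma weak_star_conv_imp_weak_conv_m:
  assumes M: "\<And>m. borel_prob_on {0..<1} (M m)" and M': "borel_prob_on {0..1} M'"
    and conv: "weak_star_conv (\<lambda>m. to_closed (M m)) M'"
  shows "weak_conv_m (\<lambda>m. distr (M m) borel (\<lambda>x. x)) (distr M' borel (\<lambda>x. x))"
proof (rule integral_bdd_continuous_conv_imp_weak_conv)
  fix f :: "real \<Rightarrow> real" assume f: "\<And>x. isCont f x"
  then have m: "f \<in> borel_measurable borel"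
    by (intro borel_measurable_continuous_onI continuous_at_imp_continuous_on) auto
  have "(\<lambda>x. x) \<in> M m \<rightarrow>\<^sub>M restrict_space borel {0..1}" for m
    using measurable_id_borel_prob_on[OF M] space_borel_prob_on[OF M]
    by (intro measurable_restrict_space2) auto
  then have "integral\<^sup>L (distr (M m) borel (\<lambda>x. x)) f = integral\<^sup>L (to_closed (M m)) f" for m
    unfolding to_closed_def using m measurable_id_borel_prob_on[OF M]
    by (simp add: integral_distr measurable_restrict_space1)
  moreover have "integral\<^sup>L (distr M' borel (\<lambda>x. x)) f = integral\<^sup>L M' f"
    using m measurable_id_borel_prob_on[OF M'] by (simp add: integral_distr)
  moreover have "continuous_on {0..1} f"
    using f by (intro continuous_at_imp_continuous_on) auto
  ultimately show "(\<lambda>m. integral\<^sup>L (distr (M m) borel (\<lambda>x. x)) f) \<longlonglongrightarrow>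
      integral\<^sup>L (distr M' borel (\<lambda>x. x)) f"
    using conv unfolding weak_star_conv_def by simp
qed (intro real_distribution_borel_prob_on[OF M] real_distribution_borel_prob_on[OF M'])+

lemma
  assumes M: "borel_prob_on {0..1} M" and null: "emeasure M {1} = 0"
  shows borel_prob_on_restrict_half_open: "borel_prob_on {0..<1} (restrict_space M {0..<1})"
    and distr_restrict_half_open:
      "distr (restrict_space M {0..<1}) borel (\<lambda>x. x) = distr M borel (\<lambda>x. x)"
proof -
  interpret prob_space M using M by (simp add: borel_prob_on_def)
  have sp: "space M = {0..1}" using space_borel_prob_on[OF M] .
  have se: "sets M = sets (restrict_space borel {0..1})" using M by (simp add: borel_prob_on_def)
  have i: "{0..1} \<inter> {0..<1} = {0..<1::real}" "{0..<1} \<inter> {0..1} = {0..<1::real}" by auto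
  have sets: "A \<in> sets M" if "A \<in> sets borel" "A \<subseteq> {0..1}" for A
    using that unfolding se by (auto simp: sets_restrict_space_iff)
  have eq: "emeasure M (B \<inter> {0..<1}) = emeasure M (B \<inter> {0..1})" if B: "B \<in> sets borel" for B
  proof (rule emeasure_eq_AE)
    \<comment> \<open>The two intersections differ at most in the point 1, which is null.\<close>
    have "AE x in M. x \<noteq> 1"
      by (rule AE_I[OF _ null]) (auto intro: sets)
    then show "AE x in M. x \<in> B \<inter> {0..<1} \<longleftrightarrow> x \<in> B \<inter> {0..1}" by eventually_elim auto
  qed (use B in \<open>auto intro!: sets\<close>)
  have "{0..<1} \<inter> space M \<in> sets M" by (intro sets) (auto simp: sp)
  then have er: "emeasure (restrict_space M {0..<1}) A = emeasure M A" if "A \<subseteq> {0..<1}" for A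
    using that by (rule emeasure_restrict_space)
  have "prob_space (restrict_space M {0..<1})"
    using eq[of UNIV] emeasure_space_1
    by (intro prob_spaceI) (simp add: space_restrict_space sp i er)
  moreover have "sets (restrict_space M {0..<1}) = sets (restrict_space borel {0..<1})"
    unfolding sets_restrict_space_cong[OF se]
    by (subst sets_restrict_restrict_space) (simp only: i)
  ultimately show b: "borel_prob_on {0..<1} (restrict_space M {0..<1})"
    by (simp add: borel_prob_on_def)
  show "distr (restrict_space M {0..<1}) borel (\<lambda>x. x) = distr M borel (\<lambda>x. x)"
    by (rule measure_eqI)
      (auto simp: emeasure_distr_id_borel_prob_on[OF b] emeasure_distr_id_borel_prob_on[OF M] er eq)
qed

theorem theorem2:
  fixes n :: nat
    and t c :: "nat \<Rightarrow> nat \<Rightarrow> real"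
    and t' c' :: "nat \<Rightarrow> real"
    and S :: "nat \<Rightarrow> real \<Rightarrow> real" and S' :: "real \<Rightarrow> real"
    and \<mu> :: "nat \<Rightarrow> real measure" and \<mu>' :: "real measure"
  assumes "\<And>m. itm n (t m) (c m) (S m)"
    and "itm n t' c' S'"
    and "\<And>k. k \<in> {0..n} \<Longrightarrow> (\<lambda>m. t m k) \<longlonglongrightarrow> t' k"
    and "\<And>k. k \<in> {1..n} \<Longrightarrow> (\<lambda>m. c m k) \<longlonglongrightarrow> c' k"
    and "\<And>m. itm_invariant (S m) (\<mu> m)"
    and "borel_prob_on {0..1} \<mu>'"
    and "weak_star_conv (\<lambda>m. to_closed (\<mu> m)) \<mu>'"
    and "\<And>k. k \<in> {0..n} \<Longrightarrow> emeasure \<mu>' {t' k} = 0"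
  shows "itm_invariant S' (restrict_space \<mu>' {0..<1})"
proof -
  note itm = assms(1,2) and lim = assms(3,4) and inv = assms(5) and \<mu>' = assms(6)
    and conv = assms(7) and null = assms(8)
  define N where "N m = distr (\<mu> m) borel (\<lambda>x. x)" for m
  define N' where "N' = distr \<mu>' borel (\<lambda>x. x)"
  have \<mu>: "borel_prob_on {0..<1} (\<mu> m)" for m using inv by (simp add: itm_invariant_def)
  \<comment> \<open>As \<open>t' n = 1\<close>, the hypothesis on endpoints prevents mass from
    escaping to 1 in the limit.\<close>
  have "emeasure \<mu>' {1} = 0" using null[of n] itm(2) by (simp add: itm_def)
  note b = borel_prob_on_restrict_half_open[OF \<mu>' this]
    and N'_eq = distr_restrict_half_open[OF \<mu>' this, folded N'_def]
  have N: "real_distribution (N m)" for m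
    unfolding N_def using real_distribution_borel_prob_on[OF \<mu>] .
  have N': "real_distribution N'"
    unfolding N'_def using real_distribution_borel_prob_on[OF \<mu>'] .
  have NN': "weak_conv_m N N'"
    using weak_star_conv_imp_weak_conv_m[OF \<mu> \<mu>' conv] by (simp add: N_def[abs_def] N'_def)
  have "AE x in N'. x \<in> {0..<1} - t' ` {0..n}"
  proof -
    have 1: "emeasure N' B = 0" if "B \<in> sets borel" "emeasure \<mu>' (B \<inter> {0..1}) = 0" for B
      unfolding N'_def using emeasure_distr_id_borel_prob_on[OF \<mu>' that(1)] that(2) by simp
    \<comment> \<open>\<open>N'\<close> is concentrated on \<open>[0,1]\<close>, whose only point
      outside \<open>[0,1)\<close> is the endpoint \<open>t' n\<close>, removed next with the other
      endpoints.\<close>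
    have "AE x in N'. x \<notin> {0..<1} \<longrightarrow> x = t' n"
      by (rule AE_I[where N="- {0..1}", OF _ 1]) (use itm(2) in \<open>auto simp: N'_def itm_def\<close>)
    moreover have "AE x in N'. \<forall>k\<in>{0..n}. x \<noteq> t' k"
    proof (rule AE_finite_allI)
      fix k assume k: "k \<in> {0..n}"
      have "emeasure \<mu>' ({t' k} \<inter> {0..1}) = 0"
        using null[OF k] by (cases "t' k \<in> {0..1}") auto
      then show "AE x in N'. x \<noteq> t' k"
        by (intro AE_I[where N="{t' k}", OF _ 1]) (auto simp: N'_def)
    qed simp
    ultimately show ?thesis by eventually_elim auto
  qed
  then have "AE x in N'. \<forall>X. X \<longlonglongrightarrow> x \<longrightarrow> (\<lambda>m. zero_ext (S m) (X m)) \<longlonglongrightarrow> zero_ext S' x"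
    by eventually_elim (use itm_continuous_convergence[OF itm lim] in blast)
  then have "weak_conv_m (\<lambda>m. distr (N m) borel (zero_ext (S m))) (distr N' borel (zero_ext S'))"
    using zero_ext_measurable itm by (intro weak_conv_m_distr_extended N N' NN') blast+
  moreover have "distr (N m) borel (zero_ext (S m)) = N m" for m
    using itm_invariant_iff_distr[OF itm(1) \<mu>] inv by (simp add: N_def)
  \<comment> \<open>By invariance the push-forwards form the sequence \<open>N\<close> itself, which
    thus has two weak limits.\<close>
  ultimately have "weak_conv_m N (distr N' borel (zero_ext S'))" by simp
  moreover have "real_distribution (distr N' borel (zero_ext S'))"
    using N' zero_ext_measurable[OF itm(2)]
    by (intro prob_space.real_distribution_distr) (auto simp: real_distribution_def N'_def)
  ultimately have "distr N' borel (zero_ext S') = N'"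
    by (intro weak_conv_m_unique[OF N _ N' _ NN'])
  then show ?thesis
    unfolding itm_invariant_iff_distr[OF itm(2) b] N'_eq .
qed

end
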